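(* Let $\mu$ be an even Borel probability measure on $\mathbb{R}/\mathbb{Z}$ (i.e. $\mu(A)=\mu(-A)$ for all Borel $A$) and let $N\ge1$. Then $$\rho(\mu,N)=\Lambda(\mu,N+1).$$
   Context: For $x\in\mathbb{R}/\mathbb{Z}$, $|x|$ is the distance from $x$ to $0$ in $\mathbb{R}/\mathbb{Z}$ and $B_r(0)=\{x:|x|<r\}$. $f:\mathbb{R}/\mathbb{Z}\to\mathbb{R}$ is eventually non-negative if $f\ge0$ outside $B_r(0)$ for some $r>0$, and $\mathrm{r}(f)=\inf\{r>0:f\ge0\text{ on }(\mathbb{R}/\mathbb{Z})\setminus B_r(0)\}$. For $N\ge1$, $\mathcal{T}(\mu,N)$ is the set of real-valued, eventually non-negative trigonometric polynomials $f(x)=\sum_{n=-N}^N\widehat f(n)e^{2\pi inx}$ with $\int f\,d\mu\le0$, and $\rho(\mu,N)=\inf_{0\not\equiv f\in\mathcal{T}(\mu,N)}\mathrm{r}(f)$. A finite set $\xi=\{\xi_1,\dots,\xi_M\}\subset\mathbb{R}/\mathbb{Z}$ of $M$ points is a set of nodes of a quadrature (for $\mu$) if there exist weights $\lambda_j\in(0,1]$, $1\le j\le M$, such that $$\int_{\mathbb{R}/\mathbb{Z}}f(x)\,d\mu(x)=\sum_{j=1}^M\lambda_jf(\xi_j)$$ for every trigonometric polynomial $f(x)=\sum_{|n|\le M-1}\widehat f(n)e^{2\pi inx}$. Define $$\Lambda(\mu,M)=\sup_{\#\xi=M}\min\{|\xi_j|:\xi_j\in\xi\},$$ the supremum being over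 all sets of nodes $\xi$ with $M$ points; if there are none, the supremum is taken to be $0$. *)

theory Defs
  imports "HOL-Probability.Probability"
begin

definition int_cong :: "real \<Rightarrow> real \<Rightarrow> bool" where
  "int_cong s t \<longleftrightarrow> s - t \<in> \<int>"

lemma equivp_int_cong: "equivp int_cong"
proof (rule equivpI)
  show "reflp int_cong"
    by (simp add: int_cong_def reflp_def)
  show "symp int_cong"
    unfolding int_cong_def symp_def by (metis Ints_minus minus_diff_eq)
  show "transp int_cong"
  proof (rule transpI)
    fix r s t :: real
    assume "int_cong r s" "int_cong s t"
    then have "(r - s) + (s - t) \<in> \<int>"
      unfolding int_cong_def by (rule Ints_add)
    then show "int_cong r t"
      by (simp add: int_cong_def)
  qed
qed

quotient_type circle = real / int_cong
  by (rule equivp_int_cong)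

lift_definition to_circle :: "real \<Rightarrow> circle" is "\<lambda>t. t" .

lemma to_circle_surj: "\<exists>t. x = to_circle t"
  by transfer (metis Ints_0 cancel_comm_monoid_add_class.diff_cancel int_cong_def)

instantiation circle :: ab_group_add
begin

lift_definition zero_circle :: circle is "0 :: real" .

lift_definition uminus_circle :: "circle \<Rightarrow> circle" is "uminus :: real \<Rightarrow> real"
  unfolding int_cong_def by (metis Ints_minus minus_diff_minus)

lift_definition plus_circle :: "circle \<Rightarrow> circle \<Rightarrow> circle" is "(+) :: real \<Rightarrow> real \<Rightarrow> real"
  unfolding int_cong_def by (metis Ints_add add_diff_add)

definition minus_circle :: "circle \<Rightarrow> circle \<Rightarrow> circle" where
  "minus_circle x y = x + - y"

instance
proof
  fix x y z :: circle
  show "x + y + z = x + (y + z)" by transfer (simp add: int_cong_def)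
  show "x + y = y + x" by transfer (simp add: int_cong_def)
  show "0 + x = x" by transfer (simp add: int_cong_def)
  show "- x + x = 0" by transfer (simp add: int_cong_def)
  show "x - y = x + - y" by (rule minus_circle_def)
qed

end

lemma to_circle_0: "to_circle 0 = 0"
  and to_circle_add: "to_circle (s + t) = to_circle s + to_circle t"
  and to_circle_minus: "to_circle (- s) = - to_circle s"
  by (transfer, simp add: int_cong_def)+

lemma to_circle_diff: "to_circle (s - t) = to_circle s - to_circle t"
  by (metis diff_conv_add_uminus to_circle_add to_circle_minus)

lemma to_circle_eq_iff: "to_circle s = to_circle t \<longleftrightarrow> s - t \<in> \<int>"
  by transfer (simp add: int_cong_def)

definition int_dist :: "real \<Rightarrow> real" where
  "int_dist t = \<bar>t - of_int (round t)\<bar>"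

lemma int_dist_le: "int_dist t \<le> \<bar>t - of_int m\<bar>"
  unfolding int_dist_def by (rule round_diff_minimal)

lemma int_dist_add_int: "int_dist (t + of_int m) = int_dist t"
proof (rule antisym)
  show "int_dist (t + of_int m) \<le> int_dist t"
    using int_dist_le[of "t + of_int m" "round t + m"] by (simp add: int_dist_def)
  show "int_dist t \<le> int_dist (t + of_int m)"
    using int_dist_le[of t "round (t + of_int m) - m"]
    by (simp add: int_dist_def algebra_simps)
qed

lemma int_dist_cong: "s - t \<in> \<int> \<Longrightarrow> int_dist s = int_dist t"
  by (metis Ints_cases add.commute diff_add_cancel int_dist_add_int)

lemma int_dist_triangle: "int_dist (s + t) \<le> int_dist s + int_dist t"
  using int_dist_le[of "s + t" "round s + round t"] by (simp add: int_dist_def)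

lemma int_dist_minus: "int_dist (- t) = int_dist t"
  using int_dist_le[of "- t" "- round t"] int_dist_le[of t "- round (- t)"]
  by (simp add: int_dist_def)

instantiation circle :: metric_space
begin

lift_definition dist_circle :: "circle \<Rightarrow> circle \<Rightarrow> real" is "\<lambda>s t. int_dist (s - t)"
proof -
  fix s s' t t' :: real
  assume "int_cong s s'" "int_cong t t'"
  then have "(s - s') - (t - t') \<in> \<int>"
    unfolding int_cong_def by (rule Ints_diff)
  then show "int_dist (s - t) = int_dist (s' - t')"
    by (intro int_dist_cong) (simp add: algebra_simps)
qed

definition uniformity_circle :: "(circle \<times> circle) filter" where
  "uniformity_circle = (INF e\<in>{0 <..}. principal {(x, y). dist x y < e})"

definition open_circle :: "circle set \<Rightarrow> bool" where
  "open_circle U \<longleftrightarrow> (\<forall>x\<in>U. eventually (\<lambda>(x', y). x' = x \<longrightarrow> y \<in> U) uniformity)"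

instance
proof
  fix x y z :: circle
  show "dist x y = 0 \<longleftrightarrow> x = y"
  proof transfer
    fix s t :: real
    show "int_dist (s - t) = 0 \<longleftrightarrow> int_cong s t"
    proof
      assume "int_dist (s - t) = 0"
      then have "s - t = of_int (round (s - t))" by (simp add: int_dist_def)
      then show "int_cong s t" unfolding int_cong_def by (metis Ints_of_int)
    next
      assume "int_cong s t"
      then show "int_dist (s - t) = 0"
        by (auto simp: int_cong_def int_dist_def elim: Ints_cases)
    qed
  qed
  show "dist x y \<le> dist x z + dist y z"
  proof transfer
    fix s t r :: real
    show "int_dist (s - t) \<le> int_dist (s - r) + int_dist (t - r)"
      using int_dist_triangle[of "s - r" "r - t"] int_dist_minus[of "t - r"] by simp
  qed
qed (simp_all add: uniformity_circle_def open_circle_def)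

end

lemma dist_to_circle: "dist (to_circle s) (to_circle t) = int_dist (s - t)"
  by transfer simp

lemma continuous_to_circle: "continuous_on UNIV to_circle"
proof (rule continuous_onI)
  fix t e :: real
  assume "0 < e"
  moreover have "dist (to_circle s) (to_circle t) \<le> dist s t" for s
    using int_dist_le[of "s - t" 0] by (simp add: dist_to_circle dist_real_def)
  ultimately show "\<exists>d>0. \<forall>s\<in>UNIV. dist s t < d \<longrightarrow> dist (to_circle s) (to_circle t) \<le> e"
    by (meson less_imp_le order_trans)
qed

text \<open>The metric topology is the quotient topology of \<open>\<real>/\<int>\<close>.\<close>

lemma open_circle_iff: "open U \<longleftrightarrow> open (to_circle -` U)"
proof
  assume "open U"
  then show "open (to_circle -` U)"
    by (rule open_vimage) (rule continuous_to_circle)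
next
  assume op: "open (to_circle -` U)"
  show "open U"
    unfolding open_dist
  proof
    fix x
    assume "x \<in> U"
    obtain t where t: "x = to_circle t" using to_circle_surj by blast
    with \<open>x \<in> U\<close> op obtain e where "e > 0" and e: "\<And>s. dist s t < e \<Longrightarrow> to_circle s \<in> U"
      unfolding open_dist by auto
    have "y \<in> U" if "dist y x < e" for y
    proof -
      obtain s where s: "y = to_circle s" using to_circle_surj by blast
      define s' where "s' = s - of_int (round (s - t))"
      have "dist s' t = int_dist (s - t)"
        by (simp add: s'_def dist_real_def int_dist_def algebra_simps)
      then have "to_circle s' \<in> U"
        using that by (intro e) (simp add: s t dist_to_circle)
      moreover have "to_circle s' = y"
        by (simp add: s s'_def to_circle_eq_iff)
      ultimately show "y \<in> U" by simp
    qed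
    then show "\<exists>e>0. \<forall>y. dist y x < e \<longrightarrow> y \<in> U" using \<open>e > 0\<close> by blast
  qed
qed

lift_definition echar :: "int \<Rightarrow> circle \<Rightarrow> complex" is
  "\<lambda>n t. exp (2 * pi * \<i> * of_int n * of_real t)"
proof -
  fix n :: int and s t :: real
  assume "int_cong s t"
  then obtain k where "s = t + of_int k"
    unfolding int_cong_def by (metis Ints_cases add.commute diff_add_cancel)
  then have "2 * pi * \<i> * of_int n * of_real s
      = 2 * pi * \<i> * of_int n * of_real t + 2 * of_int (n * k) * pi * \<i>"
    by (simp add: algebra_simps)
  moreover have "exp (2 * of_int (n * k) * pi * \<i>) = 1"
    by (rule exp_integer_2pi) simp
  ultimately show "exp (2 * pi * \<i> * of_int n * of_real s) = exp (2 * pi * \<i> * of_int n * of_real t)"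
    by (simp add: exp_add)
qed

definition trig_poly :: "int \<Rightarrow> (circle \<Rightarrow> complex) \<Rightarrow> bool" where
  "trig_poly d f \<longleftrightarrow> (\<exists>c. \<forall>x. f x = (\<Sum>n\<in>{-d..d}. c n * echar n x))"

definition eventually_nonneg :: "(circle \<Rightarrow> real) \<Rightarrow> bool" where
  "eventually_nonneg f \<longleftrightarrow> (\<exists>r>0. \<forall>x. x \<notin> ball 0 r \<longrightarrow> 0 \<le> f x)"

definition last_sign_change :: "(circle \<Rightarrow> real) \<Rightarrow> real" where
  "last_sign_change f = Inf {r. 0 < r \<and> (\<forall>x. x \<notin> ball 0 r \<longrightarrow> 0 \<le> f x)}"

definition sign_class :: "circle measure \<Rightarrow> nat \<Rightarrow> (circle \<Rightarrow> real) set" where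
  "sign_class \<mu> N = {f. trig_poly (int N) (\<lambda>x. complex_of_real (f x)) \<and>
     eventually_nonneg f \<and> (\<integral>x. f x \<partial>\<mu>) \<le> 0}"

definition sign_uncertainty :: "circle measure \<Rightarrow> nat \<Rightarrow> real" where
  "sign_uncertainty \<mu> N = Inf {last_sign_change f |f. f \<in> sign_class \<mu> N \<and> f \<noteq> (\<lambda>x. 0)}"

definition quadrature_nodes :: "circle measure \<Rightarrow> nat \<Rightarrow> circle set \<Rightarrow> bool" where
  "quadrature_nodes \<mu> M \<xi> \<longleftrightarrow> finite \<xi> \<and> card \<xi> = M \<and>
     (\<exists>w. (\<forall>y\<in>\<xi>. 0 < w y \<and> w y \<le> 1) \<and>
       (\<forall>f. trig_poly (int M - 1) f \<longrightarrow>
          (\<integral>x. f x \<partial>\<mu>) = (\<Sum>y\<in>\<xi>. complex_of_real (w y) * f y)))"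

text \<open>The explicit case distinction is needed because the supremum of the empty
  set of reals is an unspecified number.\<close>

definition quadrature_sup :: "circle measure \<Rightarrow> nat \<Rightarrow> real" where
  "quadrature_sup \<mu> M =
     (if \<exists>\<xi>. quadrature_nodes \<mu> M \<xi>
      then Sup {Min ((\<lambda>y. dist y 0) ` \<xi>) |\<xi>. quadrature_nodes \<mu> M \<xi>} else 0)"

end

theory Submission
  imports Defs "HOL-Computational_Algebra.Fundamental_Theorem_Algebra"
begin

text \<open>
  The supremum is at most the infimum by counting zeros. Let \<open>f\<close> be admissible of degree
  \<open>N\<close> with last sign change nearer to \<open>0\<close> than all of the \<open>N + 1\<close> nodes. Then \<open>f \<ge> 0\<close>
  near every node, and the quadrature formula together with \<open>\<integral> f d\<mu> \<le> 0\<close> makes every node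
  a zero, necessarily a double one. A trigonometric polynomial of degree \<open>N\<close> with
  \<open>2N + 2\<close> zeros is \<open>0\<close> (\<open>quadrature_nodes_le_last_sign_change\<close>).

  For the other inequality there are two cases. If some nonzero trigonometric polynomial
  \<open>f \<ge> 0\<close> of degree at most \<open>N\<close> satisfies \<open>\<integral> f d\<mu> \<le> 0\<close>, that \<open>f\<close> is admissible
  without any sign change, and the infimum is \<open>0\<close>; by the first inequality so is the
  supremum. This is the degenerate case in which the support of \<open>\<mu>\<close> has at most \<open>N\<close>
  points.

  Otherwise \<open>L p = \<integral> p(cos 2\<pi>x) d\<mu>\<close> is strictly positive on nonzero polynomials of degree
  at most \<open>N\<close> that are nonnegative on \<open>[-1, 1]\<close>. Gauss quadrature for \<open>L\<close> (\<open>N\<close> odd)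
  or Gauss--Radau quadrature with node \<open>-1\<close> (\<open>N\<close> even) is exact in degree \<open>N\<close>
  (\<open>gauss_radau_quadrature\<close>). A node in \<open>]-1, 1[\<close> is the cosine of two points \<open>x\<close> and
  \<open>-x\<close> of the circle and \<open>-1\<close> of one, so the preimage has exactly \<open>N + 1\<close> points; by the evenness of
  \<open>\<mu>\<close> the lifted formula holds for all trigonometric polynomials of degree \<open>N\<close>.
  Let \<open>P\<close> be the orthogonal polynomial whose zeros are the interior nodes, \<open>s\<close> the largest
  of them and \<open>w\<close> either \<open>1\<close> or \<open>1 + t\<close>. Then \<open>g(t) = w(t) P(t)\<^sup>2 / (s - t)\<close> has
  degree \<open>N\<close> and \<open>L g = 0\<close> by orthogonality, while \<open>g \<ge> 0\<close> on \<open>[-1, s]\<close>. So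
  \<open>g(cos 2\<pi>x)\<close> is admissible and changes sign last at the node nearest to \<open>0\<close>
  (\<open>ex_extremal_quadrature\<close>).
\<close>

section \<open>Real polynomials with real simple zeros\<close>

lemma poly_map_of_real_add:
  "poly (map_poly complex_of_real (p + q)) z
    = poly (map_poly of_real p) z + poly (map_poly of_real q) z"
  by (induction p q rule: poly_induct2) (simp_all add: map_poly_pCons algebra_simps)

lemma poly_map_of_real_smult:
  "poly (map_poly complex_of_real (smult c p)) z = of_real c * poly (map_poly of_real p) z"
  by (induction p) (simp_all add: map_poly_pCons algebra_simps)

lemma poly_map_of_real_mult:
  "poly (map_poly complex_of_real (p * q)) z
    = poly (map_poly of_real p) z * poly (map_poly of_real q) z"
  by (induction p)
    (simp_all add: map_poly_pCons algebra_simps poly_map_of_real_add poly_map_of_real_smult)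

lemma poly_map_of_real:
  "poly (map_poly complex_of_real p) (of_real x) = of_real (poly p x)"
  by (induction p) (simp_all add: map_poly_pCons)

text \<open>Dividing by the quadratic leaves a remainder of degree at most one that still vanishes at
  \<open>a + b\<i>\<close>; a real linear polynomial with a non-real zero is zero.\<close>

lemma quadratic_dvd_if_complex_root:
  fixes p :: "real poly"
  assumes root: "poly (map_poly of_real p) (Complex a b) = 0" and "b \<noteq> 0"
  shows "[:a\<^sup>2 + b\<^sup>2, -2 * a, 1:] dvd p"
proof -
  define d where "d = [:a\<^sup>2 + b\<^sup>2, -2 * a, 1:]"
  have "degree (p mod d) < 2"
    using degree_mod_less[of d p] by (auto simp: d_def)
  then obtain u v where r: "p mod d = [:u, v:]"
    by (metis One_nat_def Suc_1 degree_eq_zeroE degree1_coeffs less_2_cases pCons_0_0)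
  have "poly (map_poly of_real d) (Complex a b) = 0"
    by (simp add: d_def map_poly_pCons complex_eq_iff power2_eq_square algebra_simps)
  moreover have "p = (p div d) * d + p mod d"
    by simp
  ultimately have "poly (map_poly of_real (p mod d)) (Complex a b) = 0"
    using root by (metis add_0 mult_zero_right poly_map_of_real_add poly_map_of_real_mult)
  then have "v * b = 0" "u + v * a = 0"
    by (auto simp: r map_poly_pCons complex_eq_iff algebra_simps)
  then have "p mod d = 0"
    using \<open>b \<noteq> 0\<close> by (simp add: r)
  then show ?thesis
    by (simp add: d_def mod_eq_0_iff_dvd)
qed

text \<open>Real-rootedness in a form that can be tested against a functional. The quadratics
  \<open>(x - a)\<^sup>2 + b\<^sup>2\<close> cover both obstructions at once: \<open>b \<noteq> 0\<close> is a
  pair of conjugate zeros, \<open>b = 0\<close> a multiple real zero.\<close>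

lemma card_roots_eq_degree:
  fixes p :: "real poly"
  assumes "p \<noteq> 0" and "\<And>a b. \<not> [:a\<^sup>2 + b\<^sup>2, -2 * a, 1:] dvd p"
  shows "card {x. poly p x = 0} = degree p"
  using assms
proof (induction "degree p" arbitrary: p rule: less_induct)
  case less
  show ?case
  proof (cases "degree p = 0")
    case True
    then obtain c where "p = [:c:]" by (rule degree_eq_zeroE)
    with less.prems show ?thesis by simp
  next
    case False
    then have "0 < degree (map_poly complex_of_real p)"
      by (simp add: degree_map_poly)
    then obtain z where z: "poly (map_poly complex_of_real p) z = 0"
      using alg_closed_imp_poly_has_root by blast
    then have "Im z = 0"
      using quadratic_dvd_if_complex_root[of p "Re z" "Im z"] less.prems(2) by auto
    then have "poly p (Re z) = 0"
      using z poly_map_of_real[of p "Re z"] by (simp add: complex_is_Real_iff)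
    then obtain q where q: "p = [:- Re z, 1:] * q"
      by (auto simp: poly_eq_0_iff_dvd dvd_def)
    have "q \<noteq> 0" using less.prems(1) q by auto
    then have deg: "degree p = Suc (degree q)"
      by (subst q, subst degree_mult_eq) auto
    have "poly q (Re z) \<noteq> 0"
    proof
      assume "poly q (Re z) = 0"
      then have "[:- Re z, 1:] * [:- Re z, 1:] dvd p"
        unfolding q by (intro mult_dvd_mono) (auto simp: poly_eq_0_iff_dvd)
      also have "[:- Re z, 1:] * [:- Re z, 1:] = [:(Re z)\<^sup>2 + 0\<^sup>2, -2 * Re z, 1:]"
        by (simp add: power2_eq_square)
      finally show False using less.prems(2) by blast
    qed
    moreover have "{x. poly p x = 0} = insert (Re z) {x. poly q x = 0}"
      by (auto simp: q)
    moreover have "card {x. poly q x = 0} = degree q"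
    proof (rule less.hyps)
      show "degree q < degree p" using deg by simp
      show "\<not> [:a\<^sup>2 + b\<^sup>2, -2 * a, 1:] dvd q" for a b
        using less.prems(2)[of a b] q by (metis dvd_mult)
    qed fact
    ultimately show ?thesis
      using \<open>q \<noteq> 0\<close> by (simp add: deg poly_roots_finite)
  qed
qed

section \<open>Orthogonal polynomials of a functional\<close>

locale poly_functional =
  fixes M :: "real poly \<Rightarrow> real"
  assumes add: "M (p + q) = M p + M q"
    and smult: "M (smult c p) = c * M p"
begin

lemma zero: "M 0 = 0"
  using smult[of 0 0] by simp

lemma minus: "M (- p) = - M p"
  using smult[of "-1" p] by simp

lemma diff: "M (p - q) = M p - M q"
  using add[of p "- q"] by (simp add: minus)

lemma sum: "M (\<Sum>i\<in>A. f i) = (\<Sum>i\<in>A. M (f i))"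
  by (induction A rule: infinite_finite_induct) (simp_all add: zero add)

text \<open>Gram--Schmidt, one degree at a time: \<open>e\<close> is the monomial of degree \<open>n\<close> minus its
  projection to lower degrees, and the new projection adds the component along \<open>e\<close>. The
  space of polynomials of degree below \<open>n\<close> is described by its coefficients so that it is
  the zero space for \<open>n = 0\<close>.\<close>

lemma ex_orthogonal_projection:
  assumes pos: "\<And>q. q \<noteq> 0 \<Longrightarrow> degree q < k \<Longrightarrow> 0 < M (q * q)" and "n \<le> k"
  shows "\<exists>q. (\<forall>i\<ge>n. coeff q i = 0) \<and> (\<forall>r. (\<forall>i\<ge>n. coeff r i = 0) \<longrightarrow> M ((p - q) * r) = 0)"
  using \<open>n \<le> k\<close>
proof (induction n arbitrary: p)
  case 0
  have "r = 0" if "\<forall>i\<ge>0. coeff r i = 0" for r :: "real poly"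
    using that by (simp add: poly_eq_iff)
  then have "M ((p - 0) * r) = 0" if "\<forall>i\<ge>0. coeff r i = 0" for r
    using that by (metis mult_zero_right zero)
  then show ?case by (intro exI[of _ 0]) simp
next
  case (Suc n)
  obtain m where m: "\<And>i. n \<le> i \<Longrightarrow> coeff m i = 0"
    "\<And>r. \<forall>i\<ge>n. coeff r i = 0 \<Longrightarrow> M ((monom 1 n - m) * r) = 0"
    using Suc.IH[of "monom 1 n"] Suc.prems by auto
  obtain q where q: "\<And>i. n \<le> i \<Longrightarrow> coeff q i = 0"
    "\<And>r. \<forall>i\<ge>n. coeff r i = 0 \<Longrightarrow> M ((p - q) * r) = 0"
    using Suc.IH[of p] Suc.prems by auto
  define e where "e = monom 1 n - m"
  have e_n: "coeff e n = 1"
    by (auto simp: e_def m)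
  have e_gt: "coeff e i = 0" if "Suc n \<le> i" for i
    using that by (auto simp: e_def m)
  have "e \<noteq> 0" using e_n by auto
  moreover have "degree e \<le> n"
    using e_gt by (intro degree_le) auto
  ultimately have "0 < M (e * e)"
    using pos[of e] Suc.prems by auto
  define c where "c = M ((p - q) * e) / M (e * e)"
  have "M ((p - (q + smult c e)) * r) = 0" if r: "\<forall>i\<ge>Suc n. coeff r i = 0" for r
  proof -
    define r' where "r' = r - smult (coeff r n) e"
    have r': "\<forall>i\<ge>n. coeff r' i = 0"
      using r e_gt by (auto simp: r'_def e_n dest!: le_neq_implies_less)
    have "r = r' + smult (coeff r n) e"
      by (simp add: r'_def)
    moreover have "M ((p - (q + smult c e)) * (r' + smult (coeff r n) e))
        = M ((p - q) * r') - c * M (e * r') + coeff r n * (M ((p - q) * e) - c * M (e * e))"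
    proof -
      have "(p - (q + smult c e)) * (r' + smult (coeff r n) e)
          = (p - q) * r' - smult c (e * r') + smult (coeff r n) ((p - q) * e - smult c (e * e))"
        by (simp add: algebra_simps smult_diff_right)
      then show ?thesis by (simp only: add diff smult)
    qed
    moreover have "M ((p - q) * r') = 0" "M (e * r') = 0"
      using q(2)[OF r'] m(2)[OF r'] by (simp_all add: e_def)
    ultimately show ?thesis
      using \<open>0 < M (e * e)\<close> by (simp add: c_def)
  qed
  moreover have "\<forall>i\<ge>Suc n. coeff (q + smult c e) i = 0"
    using e_gt q(1) by simp
  ultimately show ?case by blast
qed

lemma ex_orthogonal_poly:
  assumes "\<And>q. q \<noteq> 0 \<Longrightarrow> degree q < k \<Longrightarrow> 0 < M (q * q)"
  obtains P where "degree P = k" "P \<noteq> 0" "\<And>r. degree r < k \<Longrightarrow> M (P * r) = 0"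
proof -
  obtain q where q: "\<And>i. k \<le> i \<Longrightarrow> coeff q i = 0"
    "\<And>r. \<forall>i\<ge>k. coeff r i = 0 \<Longrightarrow> M ((monom 1 k - q) * r) = 0"
    using ex_orthogonal_projection[OF assms, of k k "monom 1 k"] by auto
  have one: "coeff (monom 1 k - q) k = 1" by (simp add: q)
  have "degree (monom 1 k - q) \<le> k"
    by (intro degree_le) (auto simp: q)
  moreover have "k \<le> degree (monom 1 k - q)"
    using one by (intro le_degree) simp
  moreover have "M ((monom 1 k - q) * r) = 0" if "degree r < k" for r
    using that by (intro q(2)) (auto simp: coeff_eq_0)
  ultimately show thesis
    using one by (intro that[of "monom 1 k - q"]) auto
qed

text \<open>Here \<open>P\<close> is the orthogonal polynomial of degree \<open>k\<close>. If
  \<open>P = ((x - a)\<^sup>2 + b\<^sup>2) q\<close>, then \<open>M (P q)\<close> is the sum of \<open>M (((x - a) q)\<^sup>2) > 0\<close>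
  and \<open>b\<^sup>2 M (q\<^sup>2) \<ge> 0\<close>, contrary to orthogonality; so the zeros are real and simple.
  If \<open>P = (x - z) q\<close>, then \<open>M (P q) = 0\<close> gives \<open>M (x q\<^sup>2) = z M (q\<^sup>2)\<close>, so positivity of
  \<open>M ((1 - x) q\<^sup>2)\<close> and \<open>M ((1 + x) q\<^sup>2)\<close> puts \<open>z\<close> strictly between \<open>-1\<close> and
  \<open>1\<close>.\<close>

lemma orthogonal_poly_roots:
  assumes right: "\<And>q. q \<noteq> 0 \<Longrightarrow> degree q < k \<Longrightarrow> 0 < M ([:1, -1:] * (q * q))"
    and left: "\<And>q. q \<noteq> 0 \<Longrightarrow> degree q < k \<Longrightarrow> 0 < M ([:1, 1:] * (q * q))"
    and "degree P = k" "P \<noteq> 0" and orth: "\<And>r. degree r < k \<Longrightarrow> M (P * r) = 0"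
  shows "card {x. poly P x = 0} = k" and "poly P x = 0 \<Longrightarrow> -1 < x \<and> x < 1"
proof -
  have split: "M ([:c, d:] * q) = c * M q + d * M ([:0, 1:] * q)" for c d q
  proof -
    have "[:c, d:] * q = smult c q + smult d ([:0, 1:] * q)" by simp
    then show ?thesis by (simp only: add smult)
  qed
  have sq: "0 < M (q * q)" if "q \<noteq> 0" "degree q < k" for q
    using right[OF that] left[OF that] split[of 1 1 "q * q"] split[of 1 "-1" "q * q"] by simp
  have no_quadratic: "\<not> [:a\<^sup>2 + b\<^sup>2, -2 * a, 1:] dvd P" for a b
  proof
    assume "[:a\<^sup>2 + b\<^sup>2, -2 * a, 1:] dvd P"
    then obtain q where q: "P = [:a\<^sup>2 + b\<^sup>2, -2 * a, 1:] * q" by (rule dvdE)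
    have "q \<noteq> 0" using q \<open>P \<noteq> 0\<close> by auto
    then have deg: "k = 2 + degree q"
      using \<open>degree P = k\<close> by (simp only: q, subst (asm) degree_mult_eq) auto
    have deg': "degree ([:-a, 1:] * q) = 1 + degree q"
      using \<open>q \<noteq> 0\<close> by (subst degree_mult_eq) auto
    have "P * q = ([:-a, 1:] * q) * ([:-a, 1:] * q) + smult (b\<^sup>2) (q * q)"
      unfolding poly_eq_poly_eq_iff[symmetric] fun_eq_iff
      by (simp add: q power2_eq_square algebra_simps)
    then have "M (P * q) = M (([:-a, 1:] * q) * ([:-a, 1:] * q)) + b\<^sup>2 * M (q * q)"
      by (simp only: add smult)
    moreover have "0 < M (([:-a, 1:] * q) * ([:-a, 1:] * q))"
      using \<open>q \<noteq> 0\<close> deg deg' by (intro sq) (auto simp del: mult_pCons_left)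
    moreover have "0 < M (q * q)"
      using \<open>q \<noteq> 0\<close> deg by (intro sq) auto
    moreover have "0 \<le> b\<^sup>2 * M (q * q)"
      using \<open>0 < M (q * q)\<close> by simp
    moreover have "M (P * q) = 0"
      using deg by (intro orth) simp
    ultimately show False by linarith
  qed
  then show "card {x. poly P x = 0} = k"
    using card_roots_eq_degree[OF \<open>P \<noteq> 0\<close>] \<open>degree P = k\<close> by simp
  assume "poly P x = 0"
  then obtain q where q: "P = [:-x, 1:] * q"
    by (auto simp: poly_eq_0_iff_dvd dvd_def)
  have "q \<noteq> 0" using q \<open>P \<noteq> 0\<close> by auto
  then have "k = 1 + degree q"
    using \<open>degree P = k\<close> by (simp only: q, subst (asm) degree_mult_eq) auto
  then have deg: "degree q < k" by simp
  have "M (P * q) = M ([:-x, 1:] * (q * q))"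
    by (simp only: q mult.assoc)
  then have "M ([:0, 1:] * (q * q)) = x * M (q * q)"
    using orth[OF deg] split[of "-x" 1 "q * q"] by simp
  moreover have "0 < M (q * q)" "0 < M (q * q) - M ([:0, 1:] * (q * q))"
    "0 < M (q * q) + M ([:0, 1:] * (q * q))"
    using sq[OF \<open>q \<noteq> 0\<close> deg] right[OF \<open>q \<noteq> 0\<close> deg] left[OF \<open>q \<noteq> 0\<close> deg]
      split[of 1 1 "q * q"] split[of 1 "-1" "q * q"] by auto
  ultimately have "0 < (1 - x) * M (q * q)" "0 < (1 + x) * M (q * q)"
    by (simp_all add: algebra_simps)
  with \<open>0 < M (q * q)\<close> show "-1 < x \<and> x < 1"
    by (simp add: zero_less_mult_iff)
qed

end

section \<open>Gauss and Gauss--Radau quadrature\<close>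

lemma lagrange_basis:
  fixes T :: "real set"
  assumes "finite T"
  obtains l where "\<And>t. t \<in> T \<Longrightarrow> degree (l t) < card T"
    "\<And>t u. t \<in> T \<Longrightarrow> u \<in> T \<Longrightarrow> poly (l t) u = (if u = t then 1 else 0)"
proof -
  define l where
    "l t = smult (1 / (\<Prod>u\<in>T - {t}. t - u)) (\<Prod>u\<in>T - {t}. [:- u, 1:])" for t
  show thesis
  proof (rule that)
    fix t assume "t \<in> T"
    have "degree (l t) \<le> degree (\<Prod>u\<in>T - {t}. [:- u, 1:])"
      unfolding l_def by (rule degree_smult_le)
    also have "\<dots> = card (T - {t})"
      by (subst degree_prod_sum_eq) auto
    also have "\<dots> < card T"
      using \<open>t \<in> T\<close> assms by (intro card_Diff1_less)
    finally show "degree (l t) < card T" .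
    fix u assume "u \<in> T"
    then show "poly (l t) u = (if u = t then 1 else 0)"
      using assms by (auto simp: l_def poly_prod)
  qed
qed

text \<open>The model is \<open>h \<mapsto> \<integral> h(cos 2\<pi>x) d\<mu>\<close> for a measure that is strictly positive on nonzero
  nonnegative trigonometric polynomials of degree at most \<open>N\<close>.\<close>

locale positive_poly_functional = poly_functional +
  fixes N :: nat
  assumes positive: "h \<noteq> 0 \<Longrightarrow> degree h \<le> N \<Longrightarrow> (\<And>t. -1 \<le> t \<Longrightarrow> t \<le> 1 \<Longrightarrow> 0 \<le> poly h t) \<Longrightarrow> 0 < M h"
begin

text \<open>Gauss quadrature for odd \<open>N\<close> and Gauss--Radau quadrature with fixed node \<open>-1\<close> for even
  \<open>N\<close>, in one argument: with \<open>w = 1\<close> or \<open>w = 1 + x\<close>, the nodes are the zeros of \<open>w P\<close>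
  where \<open>P\<close> is orthogonal for the functional \<open>q \<mapsto> M (w q)\<close>. Modulo \<open>w P\<close> every
  polynomial of degree at most \<open>N\<close> is determined by its values at the nodes, and the
  quotient contributes nothing to \<open>M\<close>.

  In the count, a node in the open interval has weight two because it is the cosine of two
  points of the circle, while \<open>-1\<close> comes from one.

  With \<open>s\<close> the largest node and \<open>P = (x - s) q\<close>, the polynomial
  \<open>g = w (s - x) q\<^sup>2 = - w P q\<close> is nonnegative to the left of \<open>s\<close> and \<open>M g = 0\<close> by
  orthogonality; on the circle it becomes the extremal sign-changing polynomial.\<close>

lemma gauss_radau_quadrature:
  assumes "1 \<le> N"
  obtains T c s g where
    "finite T" "T \<subseteq> {-1..<1}" "2 * card (T - {-1}) + card (T \<inter> {-1}) = N + 1"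
    "\<And>t. t \<in> T \<Longrightarrow> 0 < c t" "\<And>p. degree p \<le> N \<Longrightarrow> M p = (\<Sum>t\<in>T. c t * poly p t)"
    "\<And>t. t \<in> T \<Longrightarrow> t \<le> s" "g \<noteq> 0" "degree g \<le> N" "M g = 0"
    "\<And>t. -1 \<le> t \<Longrightarrow> t \<le> s \<Longrightarrow> 0 \<le> poly g t"
proof -
  define k where "k = (N + 1) div 2"
  define w :: "real poly" where "w = (if odd N then 1 else [:1, 1:])"
  have N: "N + 1 = 2 * k + degree w" and "0 < k"
    using \<open>1 \<le> N\<close> by (auto simp: k_def w_def elim!: oddE evenE)
  have [simp]: "w \<noteq> 0"
    by (simp add: w_def)
  have w_nonneg: "0 \<le> poly w t" if "-1 \<le> t" for t
    using that by (simp add: w_def)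
  \<comment> \<open>Positivity of \<open>M\<close> is only available up to degree \<open>N = 2k - 1 + deg w\<close>, exactly what
    these products reach.\<close>
  have pos_w: "0 < M (w * (d * (q * q)))"
    if "q \<noteq> 0" "degree q < k" "d \<noteq> 0" "degree d \<le> 1"
      and nonneg: "\<And>t. -1 \<le> t \<Longrightarrow> t \<le> 1 \<Longrightarrow> 0 \<le> poly d t" for q d
  proof (rule positive)
    show "w * (d * (q * q)) \<noteq> 0" using that by simp
    have "degree (w * (d * (q * q))) = degree w + (degree d + (degree q + degree q))"
      using that by (simp add: degree_mult_eq)
    then show "degree (w * (d * (q * q))) \<le> N"
      using that N by linarith
    show "0 \<le> poly (w * (d * (q * q))) t" if "-1 \<le> t" "t \<le> 1" for t
      using that w_nonneg nonneg by simp
  qed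
  interpret w: poly_functional "\<lambda>q. M (w * q)"
    by standard (simp_all add: algebra_simps add smult)
  have right: "0 < M (w * ([:1, -1:] * (q * q)))" and left: "0 < M (w * ([:1, 1:] * (q * q)))"
    and sq: "0 < M (w * (q * q))" if "q \<noteq> 0" "degree q < k" for q
    using pos_w[OF that, of "[:1, -1:]"] pos_w[OF that, of "[:1, 1:]"] pos_w[OF that, of 1]
    by (simp_all del: mult_pCons_left)
  obtain P where P: "degree P = k" "P \<noteq> 0" and orth: "\<And>r. degree r < k \<Longrightarrow> M (w * (P * r)) = 0"
    using w.ex_orthogonal_poly[OF sq] by blast
  define S where "S = {x. poly P x = 0}"
  have "card S = k" and S: "\<And>x. x \<in> S \<Longrightarrow> -1 < x \<and> x < 1"
    using w.orthogonal_poly_roots[OF right left P orth] by (auto simp: S_def)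
  have "finite S" using P by (simp add: S_def poly_roots_finite)
  define E :: "real set" where "E = (if odd N then {} else {-1})"
  define T where "T = S \<union> E"
  have T_roots: "t \<in> T \<longleftrightarrow> poly (w * P) t = 0" for t
    by (auto simp: T_def E_def S_def w_def)
  have "finite T" and "card E = degree w" and "-1 \<notin> S"
    using \<open>finite S\<close> S by (auto simp: T_def E_def w_def)
  moreover have "S \<inter> E = {}" using \<open>-1 \<notin> S\<close> by (simp add: E_def)
  ultimately have card_T: "card T = k + degree w"
    using \<open>finite S\<close> \<open>card S = k\<close> by (simp add: T_def E_def card_Un_disjoint)
  have "T - {-1} = S" "T \<inter> {-1} = E"
    using \<open>-1 \<notin> S\<close> by (auto simp: T_def E_def)
  then have count: "2 * card (T - {-1}) + card (T \<inter> {-1}) = N + 1"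
    using N \<open>card S = k\<close> \<open>card E = degree w\<close> by simp
  obtain l where l_deg: "\<And>t. t \<in> T \<Longrightarrow> degree (l t) < card T"
    and l: "\<And>t u. t \<in> T \<Longrightarrow> u \<in> T \<Longrightarrow> poly (l t) u = (if u = t then 1 else 0)"
    using lagrange_basis[OF \<open>finite T\<close>] by blast
  have deg_wP: "degree (w * P) = card T"
    using P card_T by (simp add: degree_mult_eq)
  have "0 < card T" using card_T \<open>0 < k\<close> by simp
  have exact: "M p = (\<Sum>t\<in>T. M (l t) * poly p t)" if "degree p \<le> N" for p
  proof -
    define r where "r = p mod (w * P)"
    define d where "d = p div (w * P)"
    have p: "p = w * (P * d) + r"
      by (simp add: r_def d_def mult.assoc[symmetric])
    have r_deg: "degree r < card T"
      using degree_mod_less'[of "w * P" p] deg_wP \<open>0 < card T\<close> P unfolding r_def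
      by (cases "p mod (w * P) = 0") auto
    have "degree d < k"
    proof (cases "d = 0")
      case False
      have "card T + degree d = degree (w * P * d)"
        using False P by (simp add: deg_wP[symmetric] degree_mult_eq)
      also have "w * P * d = p - r"
        by (simp add: p mult.assoc)
      also have "degree (p - r) \<le> max (degree p) (degree r)"
        by (rule degree_diff_le_max)
      finally have "card T + degree d \<le> N"
        using that r_deg by simp
      then show ?thesis using card_T N by linarith
    qed (simp add: \<open>0 < k\<close>)
    then have "M p = M r"
      by (simp add: p add orth)
    also have "r = (\<Sum>t\<in>T. smult (poly p t) (l t))"
    proof (rule poly_eqI_degree)
      show "degree r < card T" by (fact r_deg)
      show "degree (\<Sum>t\<in>T. smult (poly p t) (l t)) < card T"
        using l_deg \<open>0 < card T\<close>
        by (intro degree_sum_less) (auto intro: le_less_trans[OF degree_smult_le])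
      fix u assume "u \<in> T"
      then have "poly (\<Sum>t\<in>T. smult (poly p t) (l t)) u
          = (\<Sum>t\<in>T. if t = u then poly p u else 0)"
        unfolding poly_sum by (intro sum.cong) (auto simp: l)
      also have "\<dots> = poly p u" using \<open>u \<in> T\<close> \<open>finite T\<close> by simp
      also have "poly p u = poly r u"
        using \<open>u \<in> T\<close> T_roots[of u] by (auto simp: p)
      finally show "poly r u = poly (\<Sum>t\<in>T. smult (poly p t) (l t)) u" by simp
    qed
    finally show ?thesis by (simp add: sum smult mult.commute)
  qed
  \<comment> \<open>A nonnegative polynomial that vanishes at all other nodes isolates the weight of \<open>t\<close>.\<close>
  have test: "0 < M (l t)"
    if "t \<in> T" "h \<noteq> 0" "degree h \<le> N" "\<And>u. -1 \<le> u \<Longrightarrow> 0 \<le> poly h u"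
      "\<And>u. u \<in> T \<Longrightarrow> u \<noteq> t \<Longrightarrow> poly h u = 0" for t h
  proof -
    have "M h = (\<Sum>u\<in>T. if u = t then M (l t) * poly h t else 0)"
      unfolding exact[OF that(3)] by (intro sum.cong) (auto simp: that(5))
    also have "\<dots> = M (l t) * poly h t" using that(1) \<open>finite T\<close> by simp
    finally have "0 < M (l t) * poly h t"
      using positive[of h] that by simp
    moreover have "0 \<le> poly h t"
      using that(1,4) S by (auto simp: T_def E_def less_imp_le split: if_splits)
    ultimately show ?thesis by (auto simp: zero_less_mult_iff)
  qed
  have c_pos: "0 < M (l t)" if "t \<in> T" for t
  proof (cases "t \<in> S")
    case True
    then obtain q where q: "P = [:-t, 1:] * q"
      by (auto simp: S_def poly_eq_0_iff_dvd dvd_def)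
    have "q \<noteq> 0" using q P by auto
    then have "k = 1 + degree q"
      using P by (simp only: q, subst (asm) degree_mult_eq) auto
    show ?thesis
    proof (rule test[OF that])
      show "degree (w * (q * q)) \<le> N"
        using \<open>q \<noteq> 0\<close> N \<open>k = 1 + degree q\<close> by (simp add: degree_mult_eq)
      show "poly (w * (q * q)) u = 0" if "u \<in> T" "u \<noteq> t" for u
        using that T_roots[of u] by (simp add: q)
    qed (use \<open>q \<noteq> 0\<close> w_nonneg in auto)
  next
    case False
    then have "t = -1" "even N" using that by (auto simp: T_def E_def split: if_splits)
    then have "degree w = 1" by (simp add: w_def)
    show ?thesis
    proof (rule test[OF that])
      show "degree (P * P) \<le> N"
        using P N \<open>degree w = 1\<close> by (simp add: degree_mult_eq)
      show "poly (P * P) u = 0" if "u \<in> T" "u \<noteq> t" for u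
        using that \<open>t = -1\<close> by (auto simp: T_def E_def S_def split: if_splits)
    qed (use P in auto)
  qed
  have "S \<noteq> {}" using \<open>card S = k\<close> \<open>0 < k\<close> by auto
  define s where "s = Max S"
  have "s \<in> S" and S_le: "\<And>t. t \<in> S \<Longrightarrow> t \<le> s"
    using \<open>finite S\<close> \<open>S \<noteq> {}\<close> by (simp_all add: s_def)
  then have T_le: "t \<le> s" if "t \<in> T" for t
    using that S[OF \<open>s \<in> S\<close>] by (auto simp: T_def E_def split: if_splits)
  obtain q where q: "P = [:-s, 1:] * q"
    using \<open>s \<in> S\<close> by (auto simp: S_def poly_eq_0_iff_dvd dvd_def)
  have "q \<noteq> 0" using q P by auto
  then have k: "k = 1 + degree q"
    using P by (simp only: q, subst (asm) degree_mult_eq) auto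
  define g where "g = - (w * (P * q))"
  have g: "g = w * ([:s, -1:] * (q * q))"
    unfolding poly_eq_poly_eq_iff[symmetric] fun_eq_iff by (simp add: g_def q algebra_simps)
  show thesis
  proof (rule that)
    show "T \<subseteq> {-1..<1}"
      using S by (auto simp: T_def E_def less_imp_le split: if_splits)
    show "g \<noteq> 0" using \<open>q \<noteq> 0\<close> P by (simp add: g_def)
    show "degree g \<le> N"
      using \<open>q \<noteq> 0\<close> P N k by (simp add: g_def degree_mult_eq)
    show "M g = 0" using orth[of q] k by (simp add: g_def minus)
    show "0 \<le> poly g t" if "-1 \<le> t" "t \<le> s" for t
    proof -
      have "poly g t = poly w t * ((s - t) * (poly q t)\<^sup>2)"
        by (simp add: g power2_eq_square algebra_simps)
      then show ?thesis using that w_nonneg[of t] by simp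
    qed
  qed (fact \<open>finite T\<close> count c_pos exact T_le)+
qed

end

section \<open>Characters of the circle\<close>

lemma echar_to_circle: "echar n (to_circle t) = cis (2 * pi * of_int n * t)"
  by transfer (simp add: cis_conv_exp mult_ac)

lemma echar_0: "echar 0 x = 1"
  using to_circle_surj[of x] by (auto simp: echar_to_circle)

lemma echar_add: "echar (m + n) x = echar m x * echar n x"
  using to_circle_surj[of x] by (auto simp: echar_to_circle cis_mult algebra_simps)

lemma echar_uminus: "echar n (- x) = cnj (echar n x)"
  using to_circle_surj[of x] by (auto simp: echar_to_circle cis_cnj simp flip: to_circle_minus)

lemma echar_neg: "echar (- n) x = cnj (echar n x)"
  using to_circle_surj[of x] by (auto simp: echar_to_circle cis_cnj)

lemma norm_echar: "cmod (echar n x) = 1"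
  using to_circle_surj[of x] by (auto simp: echar_to_circle)

lemma echar_nonzero: "echar n x \<noteq> 0"
  using norm_echar[of n x] by auto

lemma echar_of_nat: "echar (int n) x = echar 1 x ^ n"
  by (induction n) (simp_all add: echar_0 echar_add)

lemma echar_1_inj: "echar 1 x = echar 1 y \<Longrightarrow> x = y"
proof -
  assume eq: "echar 1 x = echar 1 y"
  obtain s t where "x = to_circle s" "y = to_circle t"
    using to_circle_surj by blast
  moreover from this have "sin (2 * pi * s) = sin (2 * pi * t) \<and> cos (2 * pi * s) = cos (2 * pi * t)"
    using eq by (auto simp: echar_to_circle complex_eq_iff)
  then obtain k :: int where "2 * pi * s = 2 * pi * t + 2 * pi * k"
    by (auto simp: sin_cos_eq_iff)
  then have "s - t = k"
    by (metis add_diff_cancel_left' mult_left_cancel pi_neq_zero right_diff_distrib mult_eq_0_iff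
        zero_neq_numeral)
  ultimately show "x = y"
    by (simp add: to_circle_eq_iff)
qed

text \<open>The circle carries the quotient topology, so continuity can be tested on the real line.\<close>

lemma continuous_echar: "continuous_on UNIV (echar n)"
proof -
  have "open (echar n -` U)" if "open U" for U
  proof -
    have "continuous_on UNIV (\<lambda>t. echar n (to_circle t))"
      unfolding echar_to_circle by (intro continuous_intros)
    then have "open ((\<lambda>t. echar n (to_circle t)) -` U)"
      using that by (simp add: open_vimage)
    then show ?thesis
      by (simp add: open_circle_iff vimage_def)
  qed
  then show ?thesis
    by (simp add: continuous_on_open_vimage)
qed

lemma continuous_circle_uminus: "continuous_on UNIV (uminus :: circle \<Rightarrow> circle)"
proof -
  have "dist (- x) (- y) = dist x y" for x y :: circle
  proof -
    obtain s t where "x = to_circle s" "y = to_circle t"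
      using to_circle_surj by blast
    then show ?thesis
      using int_dist_minus[of "s - t"] by (simp add: dist_to_circle flip: to_circle_minus)
  qed
  then show ?thesis
    by (intro continuous_onI) (metis less_imp_le)
qed

section \<open>The cosine as a map from the circle to the interval\<close>

definition circle_cos :: "circle \<Rightarrow> real" where
  "circle_cos x = Re (echar 1 x)"

lemma circle_cos_to_circle: "circle_cos (to_circle t) = cos (2 * pi * t)"
  by (simp add: circle_cos_def echar_to_circle)

lemma circle_cos_uminus: "circle_cos (- x) = circle_cos x"
  by (simp add: circle_cos_def echar_uminus)

lemma circle_cos_bounds: "-1 \<le> circle_cos x" "circle_cos x \<le> 1" "\<bar>circle_cos x\<bar> \<le> 1"
  using to_circle_surj[of x] by (auto simp: circle_cos_to_circle)

lemma ex_centred_representative: "\<exists>t. x = to_circle t \<and> \<bar>t\<bar> = dist x 0"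
proof -
  obtain s where s: "x = to_circle s" using to_circle_surj by blast
  have "x = to_circle (s - of_int (round s))"
    by (simp add: s to_circle_eq_iff)
  moreover have "dist x 0 = \<bar>s - of_int (round s)\<bar>"
    using dist_to_circle[of s 0] by (simp add: s to_circle_0 int_dist_def)
  ultimately show ?thesis by metis
qed

lemma dist_0_le_half: "dist (x :: circle) 0 \<le> 1 / 2"
proof -
  obtain s where "x = to_circle s" using to_circle_surj by blast
  then show ?thesis
    using dist_to_circle[of s 0] of_int_round_abs_le[of s]
    by (simp add: to_circle_0 int_dist_def abs_minus_commute)
qed

lemma circle_cos_dist: "circle_cos x = cos (2 * pi * dist x 0)"
proof -
  obtain t where "x = to_circle t" "\<bar>t\<bar> = dist x 0"
    using ex_centred_representative by blast
  then show ?thesis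
    using cos_abs_real[of "2 * pi * t"] by (simp add: circle_cos_to_circle abs_mult)
qed

lemma circle_cos_antimono: "dist y 0 \<le> dist x 0 \<Longrightarrow> circle_cos x \<le> circle_cos y"
  using dist_0_le_half[of x] mult_left_mono[of "dist x 0" "1/2" "2 * pi"]
  unfolding circle_cos_dist by (intro cos_monotone_0_pi_le) auto

lemma circle_cos_fibre:
  assumes "-1 \<le> t" "t \<le> 1"
  shows "{x. circle_cos x = t}
    = {to_circle (arccos t / (2 * pi)), to_circle (- (arccos t / (2 * pi)))}" (is "?F = {?a, ?b}")
proof (intro equalityI subsetI)
  fix x assume "x \<in> ?F"
  then have "arccos t = 2 * pi * dist x 0"
    using dist_0_le_half[of x] mult_left_mono[of "dist x 0" "1/2" "2 * pi"]
    by (auto simp: circle_cos_dist arccos_cos)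
  then have "arccos t / (2 * pi) = dist x 0" by simp
  moreover obtain s where "x = to_circle s" "\<bar>s\<bar> = dist x 0"
    using ex_centred_representative by blast
  moreover from this have "s = dist x 0 \<or> s = - dist x 0" by linarith
  ultimately show "x \<in> {?a, ?b}" by (metis insertI1 insertI2)
next
  fix x assume "x \<in> {?a, ?b}"
  then show "x \<in> ?F"
    using assms circle_cos_to_circle[of "arccos t / (2 * pi)"]
    by (auto simp: circle_cos_to_circle circle_cos_uminus to_circle_minus)
qed

lemma circle_cos_surj:
  assumes "-1 \<le> t" "t \<le> 1"
  obtains x where "circle_cos x = t"
  using circle_cos_fibre[OF assms] by blast

text \<open>The fibre consists of the classes of \<open>a\<close> and \<open>-a\<close> with \<open>0 < a \<le> 1/2\<close>, which
  coincide exactly when \<open>a = 1/2\<close>.\<close>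

lemma card_circle_cos_fibre:
  assumes "-1 \<le> t" "t < 1"
  shows "card {x. circle_cos x = t} = (if t = -1 then 1 else 2)"
proof -
  define a where "a = arccos t / (2 * pi)"
  have a: "0 < a" and a_half: "a < 1 / 2" if "t \<noteq> -1"
    using assms arccos_lt_bounded[of t] that by (auto simp: a_def field_simps)
  have "to_circle a = to_circle (- a) \<longleftrightarrow> t = -1"
  proof
    assume "to_circle a = to_circle (- a)"
    then obtain k :: int where k: "2 * a = k"
      by (auto simp: to_circle_eq_iff elim!: Ints_cases)
    show "t = -1"
    proof (rule ccontr)
      assume "t \<noteq> -1"
      then have "0 < real_of_int k" "real_of_int k < 1" using a a_half k by auto
      then show False by simp
    qed
  qed (simp add: a_def to_circle_eq_iff)
  then show ?thesis
    using circle_cos_fibre[of t] assms by (auto simp: a_def)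
qed

section \<open>Trigonometric polynomials and polynomials in the cosine\<close>

lemma trig_poly_add:
  assumes "trig_poly d f" "trig_poly d g"
  shows "trig_poly d (\<lambda>x. f x + g x)"
proof -
  obtain b c where "\<And>x. f x = (\<Sum>n\<in>{-d..d}. b n * echar n x)"
    "\<And>x. g x = (\<Sum>n\<in>{-d..d}. c n * echar n x)"
    using assms unfolding trig_poly_def by blast
  then show ?thesis
    unfolding trig_poly_def
    by (intro exI[of _ "\<lambda>n. b n + c n"]) (simp add: sum.distrib distrib_right)
qed

lemma trig_poly_cmult:
  assumes "trig_poly d f"
  shows "trig_poly d (\<lambda>x. a * f x)"
proof -
  obtain c where "\<And>x. f x = (\<Sum>n\<in>{-d..d}. c n * echar n x)"
    using assms unfolding trig_poly_def by blast
  then show ?thesis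
    unfolding trig_poly_def
    by (intro exI[of _ "\<lambda>n. a * c n"]) (simp add: sum_distrib_left mult.assoc)
qed

lemma trig_poly_sum:
  assumes "\<And>i. i \<in> I \<Longrightarrow> trig_poly d (f i)"
  shows "trig_poly d (\<lambda>x. \<Sum>i\<in>I. f i x)"
  using assms
proof (induction I rule: infinite_finite_induct)
  case (insert i I)
  then show ?case by (simp add: trig_poly_add)
qed (auto simp: trig_poly_def intro!: exI[of _ "\<lambda>_. 0"])

lemma trig_poly_echar:
  assumes "\<bar>m\<bar> \<le> d"
  shows "trig_poly d (echar m)"
proof -
  have "echar m x = (\<Sum>n\<in>{-d..d}. (if n = m then 1 else 0) * echar n x)" for x
  proof -
    have "(\<Sum>n\<in>{-d..d}. (if n = m then 1 else 0) * echar n x)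
        = (\<Sum>n\<in>{-d..d}. if n = m then echar n x else 0)"
      by (intro sum.cong) auto
    also have "\<dots> = echar m x" using assms by auto
    finally show ?thesis by simp
  qed
  then show ?thesis
    unfolding trig_poly_def by (intro exI[of _ "\<lambda>n. if n = m then 1 else 0"]) blast
qed

lemma trig_poly_circle_cos_mult:
  assumes "trig_poly d f"
  shows "trig_poly (d + 1) (\<lambda>x. of_real (circle_cos x) * f x)"
proof -
  obtain c where c: "\<And>x. f x = (\<Sum>n\<in>{-d..d}. c n * echar n x)"
    using assms unfolding trig_poly_def by blast
  have cos: "complex_of_real (circle_cos x) = (echar 1 x + echar (-1) x) / 2" for x
    using complex_add_cnj[of "echar 1 x"] by (simp add: circle_cos_def echar_neg)
  have "of_real (circle_cos x) * f x
      = (\<Sum>n\<in>{-d..d}. c n / 2 * (echar (n + 1) x + echar (n + -1) x))" for x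
    unfolding c cos sum_distrib_left echar_add
    by (intro sum.cong refl) (simp add: field_simps)
  moreover have "trig_poly (d + 1)
      (\<lambda>x. \<Sum>n\<in>{-d..d}. c n / 2 * (echar (n + 1) x + echar (n + -1) x))"
    by (intro trig_poly_sum trig_poly_cmult trig_poly_add trig_poly_echar) auto
  ultimately show ?thesis by simp
qed

lemma trig_poly_circle_cos_power: "int i \<le> d \<Longrightarrow> trig_poly d (\<lambda>x. of_real (circle_cos x ^ i))"
proof (induction i arbitrary: d)
  case 0
  then show ?case using trig_poly_echar[of 0 d] by (simp add: echar_0 trig_poly_def)
next
  case (Suc i)
  then have "trig_poly (d - 1) (\<lambda>x. of_real (circle_cos x ^ i))" by simp
  from trig_poly_circle_cos_mult[OF this] show ?case by simp
qed

lemma trig_poly_poly_circle_cos: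
  assumes "degree p \<le> d"
  shows "trig_poly (int d) (\<lambda>x. of_real (poly p (circle_cos x)))"
proof -
  have "trig_poly (int d) (\<lambda>x. \<Sum>i\<le>degree p. of_real (coeff p i) * of_real (circle_cos x ^ i))"
    using assms by (intro trig_poly_sum trig_poly_cmult trig_poly_circle_cos_power) auto
  then show ?thesis by (simp add: poly_altdef)
qed

text \<open>The polynomials found here are the Chebyshev polynomials of the first kind, by their
  three-term recursion.\<close>

lemma ex_chebyshev_nat:
  "\<exists>p. degree p \<le> n \<and> (\<forall>x. poly p (circle_cos x) = Re (echar (int n) x))"
proof (induction n rule: induct_nat_012)
  case 0
  show ?case by (intro exI[of _ 1]) (simp add: echar_0)
next
  case 1
  show ?case by (intro exI[of _ "[:0, 1:]"]) (simp add: circle_cos_def)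
next
  case (ge2 n)
  then obtain p q where p: "degree p \<le> n" "\<And>x. poly p (circle_cos x) = Re (echar (int n) x)"
    and q: "degree q \<le> Suc n" "\<And>x. poly q (circle_cos x) = Re (echar (int (Suc n)) x)"
    by blast
  have "degree ([:0, 2:] * q - p) \<le> Suc (Suc n)"
    using p(1) q(1) degree_mult_le[of "[:0, 2:]" q]
    by (intro degree_diff_le) (auto simp del: mult_pCons_left)
  moreover have "poly ([:0, 2:] * q - p) (circle_cos x) = Re (echar (int (Suc (Suc n))) x)" for x
  proof -
    obtain t where x: "x = to_circle t" using to_circle_surj by blast
    have "cos (2 * pi * (2 + real n) * t) + cos (2 * pi * n * t)
        = 2 * cos (2 * pi * t) * cos (2 * pi * (1 + real n) * t)"
      using cos_plus_cos[of "2 * pi * (2 + real n) * t" "2 * pi * n * t"]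
      by (simp add: algebra_simps add_divide_distrib)
    moreover have "poly p (circle_cos x) = cos (2 * pi * n * t)"
      unfolding p(2) by (simp add: x echar_to_circle)
    moreover have "poly q (circle_cos x) = cos (2 * pi * (1 + real n) * t)"
      unfolding q(2) by (simp add: x echar_to_circle)
    moreover have "circle_cos x = cos (2 * pi * t)"
      by (simp add: x circle_cos_to_circle)
    ultimately have "poly ([:0, 2:] * q - p) (circle_cos x) = cos (2 * pi * (2 + real n) * t)"
      by simp
    then show ?thesis by (simp add: x echar_to_circle)
  qed
  ultimately show ?case by blast
qed

lemma ex_chebyshev:
  "\<exists>p. degree p \<le> nat \<bar>n\<bar> \<and> (\<forall>x. poly p (circle_cos x) = Re (echar n x))"
proof (cases "0 \<le> n")
  case True
  then show ?thesis using ex_chebyshev_nat[of "nat n"] by simp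
next
  case False
  then show ?thesis using ex_chebyshev_nat[of "nat (- n)"] by (simp add: echar_neg)
qed

lemma poly_circle_cos_nonzero:
  assumes "p \<noteq> 0"
  shows "(\<lambda>x. poly p (circle_cos x)) \<noteq> (\<lambda>x. 0)"
proof
  assume "(\<lambda>x. poly p (circle_cos x)) = (\<lambda>x. 0)"
  then have "poly p t = 0" if "t \<in> {-1..1}" for t
    using that by (metis atLeastAtMost_iff circle_cos_surj)
  then have "{-1..1} \<subseteq> {t. poly p t = 0}" by auto
  moreover have "infinite {-1..1 :: real}" by (simp add: infinite_Icc)
  ultimately show False
    using poly_roots_finite[OF assms] finite_subset by blast
qed

section \<open>Double zeros of trigonometric polynomials\<close>

text \<open>Multiplying by \<open>e\<^bsup>2\<pi>iNx\<^esup>\<close> clears the negative frequencies and makes zeros of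
  trigonometric polynomials accessible to the degree bound for ordinary ones.\<close>

lemma trig_poly_eq_poly:
  assumes "trig_poly (int N) f"
  obtains P where "degree P \<le> 2 * N" "\<And>x. poly P (echar 1 x) = echar (int N) x * f x"
proof -
  obtain c where c: "\<And>x. f x = (\<Sum>n\<in>{- int N..int N}. c n * echar n x)"
    using assms unfolding trig_poly_def by blast
  define P where "P = (\<Sum>n\<in>{- int N..int N}. monom (c n) (nat (n + int N)))"
  show thesis
  proof (rule that)
    show "degree P \<le> 2 * N"
      unfolding P_def by (intro degree_sum_le) (auto intro: order_trans[OF degree_monom_le])
    show "poly P (echar 1 x) = echar (int N) x * f x" for x
      unfolding c sum_distrib_left P_def poly_sum
    proof (intro sum.cong refl)
      fix n assume "n \<in> {- int N..int N}"
      then have "echar 1 x ^ nat (n + int N) = echar n x * echar (int N) x"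
        by (simp flip: echar_of_nat echar_add)
      then show "poly (monom (c n) (nat (n + int N))) (echar 1 x) = echar (int N) x * (c n * echar n x)"
        by (simp add: poly_monom)
    qed
  qed
qed

text \<open>A zero near which \<open>f\<close> is nonnegative is a local minimum of \<open>f\<close>, hence a critical point.
  Along the circle \<open>f\<close> is \<open>P\<close> times a unimodular factor, so where \<open>P\<close> vanishes the
  derivatives of \<open>f\<close> and \<open>P\<close> differ by a nonzero factor.\<close>

lemma trig_poly_zero_pderiv_zero:
  fixes f :: "circle \<Rightarrow> real"
  assumes P: "\<And>x. poly P (echar 1 x) = echar (int N) x * complex_of_real (f x)"
    and zero: "f y = 0" and "0 < e" and nonneg: "\<And>x. dist x y < e \<Longrightarrow> 0 \<le> f x"
  shows "poly (pderiv P) (echar 1 y) = 0"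
proof -
  obtain s where y: "y = to_circle s" using to_circle_surj by blast
  define E where "E n w = exp (2 * pi * \<i> * of_int n * w)" for n w
  have E: "E n (of_real t) = echar n (to_circle t)" for n t
    by (simp add: E_def echar_to_circle cis_conv_exp mult_ac)
  define G where "G w = poly P (E 1 w) * E (- int N) w" for w
  have G: "G (of_real t) = of_real (f (to_circle t))" for t
  proof -
    have "echar (int N) (to_circle t) * echar (- int N) (to_circle t) = 1"
      by (simp add: echar_0 flip: echar_add)
    then show ?thesis by (simp add: G_def E P mult_ac)
  qed
  have z: "poly P (E 1 (of_real s)) = 0"
    using P[of y] zero by (simp add: E y)
  define D where "D = poly (pderiv P) (E 1 (of_real s)) * (2 * pi * \<i> * E 1 (of_real s))
    * E (- int N) (of_real s)"
  have dE: "(E n has_field_derivative 2 * pi * \<i> * of_int n * E n w) (at w)" for n w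
    unfolding E_def by (auto intro!: derivative_eq_intros simp: mult_ac)
  have "(G has_field_derivative D) (at (of_real s))"
    unfolding G_def
    by (rule derivative_eq_intros DERIV_chain2[OF poly_DERIV] dE refl | simp add: z D_def)+
  then have vec: "((\<lambda>t. complex_of_real (f (to_circle t))) has_vector_derivative D) (at s)"
    using has_vector_derivative_real_field[of G D s UNIV] by (simp add: G)
  have "((\<lambda>t. f (to_circle t)) has_real_derivative Re D) (at s)"
    using bounded_linear.has_vector_derivative[OF bounded_linear_Re vec]
    by (simp add: has_real_derivative_iff_has_vector_derivative)
  then have "Re D = 0"
  proof (rule DERIV_local_min)
    show "0 < e" by fact
    show "\<forall>t. \<bar>s - t\<bar> < e \<longrightarrow> f (to_circle s) \<le> f (to_circle t)"
    proof (intro allI impI)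
      fix t assume "\<bar>s - t\<bar> < e"
      then have "dist (to_circle t) y < e"
        using int_dist_le[of "t - s" 0] by (simp add: y dist_to_circle)
      then show "f (to_circle s) \<le> f (to_circle t)"
        using nonneg zero by (simp add: y)
    qed
  qed
  \<comment> \<open>The imaginary part of \<open>G\<close> vanishes identically on the real line.\<close>
  moreover have "((\<lambda>t. 0 :: real) has_vector_derivative Im D) (at s)"
    using bounded_linear.has_vector_derivative[OF bounded_linear_Im vec] by simp
  then have "Im D = 0"
    by (rule vector_derivative_unique_at) (rule has_vector_derivative_const)
  ultimately have "D = 0" by (simp add: complex_eq_iff)
  then show ?thesis
    by (simp add: D_def E y echar_nonzero)
qed

text \<open>Each of the more than \<open>N\<close> zeros counts twice, against the bound \<open>2N\<close> for the degree of
  the associated ordinary polynomial.\<close>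

lemma trig_poly_nonneg_near_zeros:
  fixes f :: "circle \<Rightarrow> real"
  assumes "trig_poly (int N) (\<lambda>x. complex_of_real (f x))"
    and "finite \<xi>" "N < card \<xi>" and zero: "\<And>y. y \<in> \<xi> \<Longrightarrow> f y = 0"
    and near: "\<And>y. y \<in> \<xi> \<Longrightarrow> \<exists>e>0. \<forall>x. dist x y < e \<longrightarrow> 0 \<le> f x"
  shows "f = (\<lambda>x. 0)"
proof (rule ccontr)
  assume "f \<noteq> (\<lambda>x. 0)"
  obtain P where "degree P \<le> 2 * N"
    and P: "\<And>x. poly P (echar 1 x) = echar (int N) x * complex_of_real (f x)"
    using trig_poly_eq_poly[OF assms(1)] by blast
  have "P \<noteq> 0"
  proof
    assume "P = 0"
    then have "f x = 0" for x
      using P[of x] norm_echar[of "int N" x] by auto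
    with \<open>f \<noteq> (\<lambda>x. 0)\<close> show False by auto
  qed
  define Z where "Z = echar 1 ` \<xi>"
  have "card Z = card \<xi>"
    unfolding Z_def by (intro card_image inj_onI) (rule echar_1_inj)
  have double: "2 \<le> order z P" and root: "poly P z = 0" if "z \<in> Z" for z
  proof -
    obtain y where y: "y \<in> \<xi>" "z = echar 1 y"
      using \<open>z \<in> Z\<close> by (auto simp: Z_def)
    then show root: "poly P z = 0" using P[of y] zero by simp
    have "poly (pderiv P) z = 0"
      using trig_poly_zero_pderiv_zero[OF P zero[OF y(1)]] near[OF y(1)] y(2) by blast
    moreover have "pderiv P \<noteq> 0"
    proof
      assume "pderiv P = 0"
      then obtain a where "P = [:a:]"
        using pderiv_eq_0_iff degree_eq_zeroE by blast
      with root \<open>P \<noteq> 0\<close> show False by simp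
    qed
    ultimately have "order z (pderiv P) \<noteq> 0" by (simp add: order_root)
    then show "2 \<le> order z P"
      using order_pderiv[OF \<open>P \<noteq> 0\<close> root] by simp
  qed
  have "2 * card \<xi> = (\<Sum>z\<in>Z. 2)" by (simp add: \<open>card Z = card \<xi>\<close>)
  also have "\<dots> \<le> (\<Sum>z\<in>Z. order z P)" by (intro sum_mono double)
  also have "\<dots> \<le> (\<Sum>z | poly P z = 0. order z P)"
    using poly_roots_finite[OF \<open>P \<noteq> 0\<close>] root by (intro sum_mono2) auto
  also have "\<dots> \<le> degree P" by (rule sum_order_le_degree) fact
  finally show False
    using \<open>degree P \<le> 2 * N\<close> \<open>N < card \<xi>\<close> by simp
qed

section \<open>Last sign change against quadrature nodes\<close>

lemma last_sign_change_le:
  assumes "0 < r" "\<And>x. r \<le> dist x 0 \<Longrightarrow> 0 \<le> f x"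
  shows "last_sign_change f \<le> r"
  unfolding last_sign_change_def
  by (rule cInf_lower) (use assms in \<open>auto intro!: bdd_belowI[of _ 0] simp: dist_commute\<close>)

lemma last_sign_change_nonneg:
  assumes "eventually_nonneg f"
  shows "0 \<le> last_sign_change f"
  unfolding last_sign_change_def
  by (rule cInf_greatest) (use assms in \<open>auto simp: eventually_nonneg_def\<close>)

text \<open>The ball of radius one is the whole circle, whose points have distance at most \<open>1/2\<close>
  from \<open>0\<close>.\<close>

lemma eventually_nonneg_circle: "eventually_nonneg f"
  unfolding eventually_nonneg_def
proof (intro exI[of _ 1] conjI allI impI)
  fix x :: circle
  assume "x \<notin> ball 0 1"
  then show "0 \<le> f x"
    using dist_0_le_half[of x] by (simp add: dist_commute)
qed simp

text \<open>If \<open>f\<close> were nonnegative in a neighbourhood of every node, then \<open>\<integral> f d\<mu> \<le> 0\<close> and the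
  positivity of the weights would force \<open>f\<close> to vanish at all \<open>N + 1\<close> nodes, each time
  to second order; that is more than a polynomial of degree \<open>N\<close> allows.\<close>

lemma quadrature_nodes_le_last_sign_change:
  assumes nodes: "quadrature_nodes \<mu> (N + 1) \<xi>" and f: "f \<in> sign_class \<mu> N" "f \<noteq> (\<lambda>x. 0)"
  shows "Min ((\<lambda>y. dist y 0) ` \<xi>) \<le> last_sign_change f"
proof (rule ccontr)
  let ?m = "Min ((\<lambda>y. dist y 0) ` \<xi>)"
  obtain w where fin: "finite \<xi>" "card \<xi> = N + 1" and w: "\<And>y. y \<in> \<xi> \<Longrightarrow> 0 < w y"
    and exact: "\<And>g. trig_poly (int N) g \<Longrightarrow> (\<integral>x. g x \<partial>\<mu>) = (\<Sum>y\<in>\<xi>. complex_of_real (w y) * g y)"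
    using nodes unfolding quadrature_nodes_def by auto
  have trig: "trig_poly (int N) (\<lambda>x. complex_of_real (f x))"
    and ev: "eventually_nonneg f" and int: "(\<integral>x. f x \<partial>\<mu>) \<le> 0"
    using f by (auto simp: sign_class_def)
  define R where "R = {r. 0 < r \<and> (\<forall>x. x \<notin> ball 0 r \<longrightarrow> 0 \<le> f x)}"
  assume "\<not> ?m \<le> last_sign_change f"
  then have "Inf R < ?m"
    by (simp only: last_sign_change_def R_def not_le)
  moreover have "R \<noteq> {}"
    using ev by (auto simp: eventually_nonneg_def R_def)
  ultimately obtain r where "r \<in> R" "r < ?m"
    by (meson cInf_lessD)
  then have r: "\<And>x. x \<notin> ball 0 r \<Longrightarrow> 0 \<le> f x"
    by (simp add: R_def)
  have far: "r < dist y 0" if "y \<in> \<xi>" for y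
  proof -
    have "?m \<le> dist y 0" using that fin by (intro Min_le) auto
    with \<open>r < ?m\<close> show ?thesis by (rule less_le_trans)
  qed
  have near: "\<exists>e>0. \<forall>x. dist x y < e \<longrightarrow> 0 \<le> f x" if "y \<in> \<xi>" for y
  proof (intro exI[of _ "dist y 0 - r"] conjI allI impI)
    show "0 < dist y 0 - r" using far[OF that] by simp
    fix x assume "dist x y < dist y 0 - r"
    then have "r \<le> dist 0 x"
      using dist_triangle[of y 0 x] by (simp add: dist_commute)
    then show "0 \<le> f x" by (intro r) simp
  qed
  have nonneg: "0 \<le> f y" if "y \<in> \<xi>" for y
    using near[OF that] by force
  have "complex_of_real (\<integral>x. f x \<partial>\<mu>) = complex_of_real (\<Sum>y\<in>\<xi>. w y * f y)"
    using exact[OF trig] by (simp add: integral_complex_of_real)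
  then have sum_le: "(\<Sum>y\<in>\<xi>. w y * f y) \<le> 0"
    using int by (simp only: of_real_eq_iff)
  have term_nonneg: "0 \<le> w y * f y" if "y \<in> \<xi>" for y
    using w[OF that] nonneg[OF that] by simp
  have sum_0: "(\<Sum>y\<in>\<xi>. w y * f y) = 0"
    by (rule antisym[OF sum_le sum_nonneg[OF term_nonneg]])
  have "f y = 0" if "y \<in> \<xi>" for y
    using sum_nonneg_0[OF fin(1) term_nonneg sum_0 that] w[OF that] by simp
  then have "f = (\<lambda>x. 0)"
    using trig_poly_nonneg_near_zeros[OF trig fin(1)] fin(2) near by simp
  with f(2) show False by contradiction
qed

lemma quadrature_sup_nodes:
  assumes "\<exists>\<xi>. quadrature_nodes \<mu> M \<xi>"
  shows "quadrature_sup \<mu> M = Sup {Min ((\<lambda>y. dist y 0) ` \<xi>) |\<xi>. quadrature_nodes \<mu> M \<xi>}"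
  unfolding quadrature_sup_def using assms by (rule if_P)

lemma quadrature_sup_no_nodes:
  assumes "\<nexists>\<xi>. quadrature_nodes \<mu> M \<xi>"
  shows "quadrature_sup \<mu> M = 0"
  unfolding quadrature_sup_def using assms by (rule if_not_P)

section \<open>Quadrature for even measures\<close>

locale even_circle_measure = prob_space \<mu> for \<mu> :: "circle measure" +
  assumes sets_borel: "sets \<mu> = sets borel"
    and measure_reflect: "A \<in> sets borel \<Longrightarrow> measure \<mu> A = measure \<mu> (uminus ` A)"
begin

lemma measurable_eq_borel: "measurable \<mu> M = measurable borel M"
  by (rule measurable_cong_sets) (simp_all add: sets_borel)

lemma measurable_uminus: "(uminus :: circle \<Rightarrow> circle) \<in> borel_measurable borel"
  by (rule borel_measurable_continuous_onI) (rule continuous_circle_uminus)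

lemma distr_uminus: "distr \<mu> borel uminus = \<mu>"
proof (rule measure_eqI)
  fix A assume "A \<in> sets (distr \<mu> borel (uminus :: circle \<Rightarrow> circle))"
  then have A: "A \<in> sets borel" by simp
  have "space \<mu> = UNIV"
    using sets_eq_imp_space_eq[OF sets_borel] by simp
  have "(uminus :: circle \<Rightarrow> circle) -` A = uminus ` A"
    by (auto intro: rev_image_eqI)
  then have "emeasure (distr \<mu> borel uminus) A = emeasure \<mu> (uminus ` A)"
    using A measurable_uminus \<open>space \<mu> = UNIV\<close>
    by (subst emeasure_distr) (simp_all add: measurable_eq_borel)
  then show "emeasure (distr \<mu> borel uminus) A = emeasure \<mu> A"
    using measure_reflect[OF A] by (simp add: emeasure_eq_measure)
qed (simp add: sets_borel)

lemma borel_measurable_echar: "echar n \<in> borel_measurable borel"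
  by (rule borel_measurable_continuous_onI) (rule continuous_echar)

lemma integrable_echar: "integrable \<mu> (echar n)"
  by (rule integrable_const_bound[of _ 1])
    (auto simp: norm_echar measurable_eq_borel borel_measurable_echar)

lemma integrable_poly_circle_cos: "integrable \<mu> (\<lambda>x. poly p (circle_cos x))"
proof -
  have "circle_cos \<in> borel_measurable borel"
    unfolding circle_cos_def[abs_def] using borel_measurable_echar by measurable
  then have "integrable \<mu> (\<lambda>x. circle_cos x ^ i)" for i
    using circle_cos_bounds(3)
    by (intro integrable_const_bound[of _ 1])
      (auto simp: measurable_eq_borel power_abs power_le_one)
  then show ?thesis by (simp add: poly_altdef)
qed

text \<open>Reflecting a character conjugates it, so the Fourier coefficients of a reflection-invariant
  measure are real.\<close>

lemma integral_echar: "(\<integral>x. echar n x \<partial>\<mu>) = complex_of_real (\<integral>x. Re (echar n x) \<partial>\<mu>)"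
proof -
  have "(\<integral>x. echar n x \<partial>\<mu>) = (\<integral>x. echar n x \<partial>distr \<mu> borel uminus)"
    by (simp add: distr_uminus)
  also have "\<dots> = (\<integral>x. echar n (- x) \<partial>\<mu>)"
    using measurable_uminus borel_measurable_echar
    by (intro integral_distr) (simp_all add: measurable_eq_borel)
  also have "\<dots> = cnj (\<integral>x. echar n x \<partial>\<mu>)"
    by (simp add: echar_uminus)
  finally have "Im (\<integral>x. echar n x \<partial>\<mu>) = 0"
    by (simp add: complex_eq_iff)
  then show ?thesis
    using integrable_echar[of n] by (simp add: complex_eq_iff)
qed

text \<open>For a symmetric rule both sides are real on the exponentials, so only their real parts
  matter, and these are polynomials in the cosine.\<close>

lemma exact_on_trig_poly:
  assumes "finite \<xi>" and sym: "uminus ` \<xi> = \<xi>" and w_sym: "\<And>y. w (- y) = w y"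
    and exact: "\<And>p. degree p \<le> N \<Longrightarrow>
      (\<integral>x. poly p (circle_cos x) \<partial>\<mu>) = (\<Sum>y\<in>\<xi>. w y * poly p (circle_cos y))"
    and "trig_poly (int N) f"
  shows "(\<integral>x. f x \<partial>\<mu>) = (\<Sum>y\<in>\<xi>. complex_of_real (w y) * f y)"
proof -
  have char: "(\<integral>x. echar n x \<partial>\<mu>) = (\<Sum>y\<in>\<xi>. complex_of_real (w y) * echar n y)"
    if "n \<in> {- int N..int N}" for n
  proof -
    obtain p where "degree p \<le> nat \<bar>n\<bar>" and p: "\<And>x. poly p (circle_cos x) = Re (echar n x)"
      using ex_chebyshev by blast
    then have "degree p \<le> N" using that by auto
    define S where "S = (\<Sum>y\<in>\<xi>. complex_of_real (w y) * echar n y)"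
    have "S = (\<Sum>y\<in>uminus ` \<xi>. complex_of_real (w y) * echar n y)"
      by (simp add: S_def sym)
    also have "\<dots> = cnj S"
      unfolding S_def by (subst sum.reindex) (simp_all add: echar_uminus w_sym)
    finally have "Im S = 0"
      by (simp add: complex_eq_iff)
    moreover have "(\<integral>x. Re (echar n x) \<partial>\<mu>) = (\<Sum>y\<in>\<xi>. w y * Re (echar n y))"
      using exact[OF \<open>degree p \<le> N\<close>] by (simp add: p)
    ultimately show ?thesis
      by (simp add: integral_echar complex_eq_iff S_def)
  qed
  obtain c where c: "\<And>x. f x = (\<Sum>n\<in>{- int N..int N}. c n * echar n x)"
    using \<open>trig_poly (int N) f\<close> unfolding trig_poly_def by blast
  have "(\<integral>x. f x \<partial>\<mu>) = (\<Sum>n\<in>{- int N..int N}. c n * (\<Sum>y\<in>\<xi>. complex_of_real (w y) * echar n y))"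
    unfolding c using integrable_echar by (simp add: char)
  also have "\<dots> = (\<Sum>y\<in>\<xi>. complex_of_real (w y) * f y)"
    unfolding c sum_distrib_left by (subst sum.swap) (simp add: mult_ac)
  finally show ?thesis .
qed

text \<open>The rule on \<open>[-1, 1]\<close> lifts along the cosine, the weight of a node being shared equally by
  its preimages. The polynomial \<open>f\<close> changes sign last at the node closest to \<open>0\<close>, which
  has the largest cosine.\<close>

lemma ex_extremal_quadrature:
  assumes "1 \<le> N"
    and pos: "\<And>f. trig_poly (int N) (\<lambda>x. complex_of_real (f x)) \<Longrightarrow> f \<noteq> (\<lambda>x. 0) \<Longrightarrow>
      (\<And>x. 0 \<le> f x) \<Longrightarrow> 0 < (\<integral>x. f x \<partial>\<mu>)"
  obtains \<xi> f where "quadrature_nodes \<mu> (N + 1) \<xi>" "f \<in> sign_class \<mu> N" "f \<noteq> (\<lambda>x. 0)"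
    "\<And>y. y \<in> \<xi> \<Longrightarrow> last_sign_change f \<le> dist y 0"
proof -
  define L where "L p = (\<integral>x. poly p (circle_cos x) \<partial>\<mu>)" for p
  interpret L: positive_poly_functional L N
  proof
    show "0 < L h" if "h \<noteq> 0" "degree h \<le> N" "\<And>t. -1 \<le> t \<Longrightarrow> t \<le> 1 \<Longrightarrow> 0 \<le> poly h t" for h
      unfolding L_def
    proof (rule pos)
      show "0 \<le> poly h (circle_cos x)" for x
        using that(3) circle_cos_bounds by blast
    qed (fact trig_poly_poly_circle_cos[OF that(2)] poly_circle_cos_nonzero[OF that(1)])+
  qed (simp_all add: L_def integrable_poly_circle_cos)
  obtain T c s g where T: "finite T" "T \<subseteq> {-1..<1}" "2 * card (T - {-1}) + card (T \<inter> {-1}) = N + 1"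
    and c: "\<And>t. t \<in> T \<Longrightarrow> 0 < c t"
    and exact: "\<And>p. degree p \<le> N \<Longrightarrow> L p = (\<Sum>t\<in>T. c t * poly p t)"
    and T_le: "\<And>t. t \<in> T \<Longrightarrow> t \<le> s"
    and g: "g \<noteq> 0" "degree g \<le> N" "L g = 0" "\<And>t. -1 \<le> t \<Longrightarrow> t \<le> s \<Longrightarrow> 0 \<le> poly g t"
    using L.gauss_radau_quadrature[OF \<open>1 \<le> N\<close>] by blast
  define F where "F t = {x. circle_cos x = t}" for t
  have card_F: "card (F t) = (if t = -1 then 1 else 2)" if "t \<in> T" for t
    unfolding F_def using that T(2) by (intro card_circle_cos_fibre) auto
  have fin_F: "finite (F t)" and card_F_pos: "0 < real (card (F t))" if "t \<in> T" for t
    using card_F[OF that] card_ge_0_finite[of "F t"] by (auto split: if_splits)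
  define \<xi> where "\<xi> = {x. circle_cos x \<in> T}"
  define w where "w y = c (circle_cos y) / card (F (circle_cos y))" for y
  have \<xi>: "\<xi> = (\<Union>t\<in>T. F t)" by (auto simp: \<xi>_def F_def)
  have fin: "finite \<xi>" using T(1) fin_F by (simp add: \<xi>)
  have "card \<xi> = (\<Sum>t\<in>T. card (F t))"
    unfolding \<xi> by (rule card_UN_disjoint) (use T(1) fin_F in \<open>auto simp: F_def\<close>)
  also have "\<dots> = (\<Sum>t\<in>T. if t = -1 then 1 else 2)"
    using card_F by simp
  also have "\<dots> = (\<Sum>t\<in>T \<inter> {-1}. 1) + (\<Sum>t\<in>T - {-1}. 2)"
    using T(1) by (subst sum.If_cases) (simp_all add: Diff_eq Compl_eq)
  finally have card: "card \<xi> = N + 1" using T(3) by simp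
  have group: "(\<Sum>y\<in>\<xi>. w y * h (circle_cos y)) = (\<Sum>t\<in>T. c t * h t)" for h
  proof -
    have "(\<Sum>y\<in>\<xi>. w y * h (circle_cos y)) = (\<Sum>t\<in>T. \<Sum>y\<in>F t. w y * h (circle_cos y))"
      unfolding \<xi> by (rule sum.UNION_disjoint) (use T(1) fin_F in \<open>auto simp: F_def\<close>)
    also have "\<dots> = (\<Sum>t\<in>T. \<Sum>y\<in>F t. c t / card (F t) * h t)"
      by (intro sum.cong refl) (auto simp: F_def w_def)
    also have "\<dots> = (\<Sum>t\<in>T. c t * h t)"
      by (intro sum.cong refl) (simp add: card_F)
    finally show ?thesis .
  qed
  have w_pos: "0 < w y" if "y \<in> \<xi>" for y
    using that c card_F_pos by (simp add: w_def \<xi>_def)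
  have "(\<Sum>y\<in>\<xi>. w y) = L 1"
    using group[of "\<lambda>_. 1"] exact[of 1] by simp
  also have "L 1 = 1" by (simp add: L_def prob_space)
  finally have w_le: "w y \<le> 1" if "y \<in> \<xi>" for y
    using member_le_sum[of y \<xi> w] that fin w_pos by (auto simp: less_imp_le)
  have sym: "uminus ` \<xi> = \<xi>"
    by (auto simp: \<xi>_def circle_cos_uminus intro: rev_image_eqI[of "- _"])
  have "(\<integral>x. f x \<partial>\<mu>) = (\<Sum>y\<in>\<xi>. complex_of_real (w y) * f y)" if "trig_poly (int N) f" for f
  proof (rule exact_on_trig_poly[OF fin sym _ _ that])
    show "w (- y) = w y" for y by (simp add: w_def circle_cos_uminus)
    show "(\<integral>x. poly p (circle_cos x) \<partial>\<mu>) = (\<Sum>y\<in>\<xi>. w y * poly p (circle_cos y))"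
      if "degree p \<le> N" for p
      using exact[OF that] by (simp add: L_def group)
  qed
  then have nodes: "quadrature_nodes \<mu> (N + 1) \<xi>"
    unfolding quadrature_nodes_def using fin card w_pos w_le by (auto intro!: exI[of _ w])
  define f where "f x = poly g (circle_cos x)" for x
  show thesis
  proof (rule that[OF nodes])
    show "f \<in> sign_class \<mu> N"
      using trig_poly_poly_circle_cos[OF g(2)] g(3) eventually_nonneg_circle[of f]
      by (simp add: sign_class_def f_def[abs_def] L_def)
    show "f \<noteq> (\<lambda>x. 0)"
      unfolding f_def using poly_circle_cos_nonzero[OF g(1)] .
    fix y assume "y \<in> \<xi>"
    then have y: "circle_cos y \<in> T" by (simp add: \<xi>_def)
    then have "y \<noteq> 0" using T(2) by (auto simp: circle_cos_dist)
    then show "last_sign_change f \<le> dist y 0"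
    proof (intro last_sign_change_le)
      fix x :: circle assume "dist y 0 \<le> dist x 0"
      then have "circle_cos x \<le> s"
        using circle_cos_antimono T_le[OF y] order_trans by blast
      then show "0 \<le> f x"
        using circle_cos_bounds by (simp add: f_def g(4))
    qed simp
  qed
qed

section \<open>The two extremal problems\<close>

text \<open>This makes the infimum defining \<open>sign_uncertainty\<close> one over a nonempty set and, by
  \<open>quadrature_nodes_le_last_sign_change\<close>, bounds the supremum defining
  \<open>quadrature_sup\<close>.\<close>

lemma minus_one_in_sign_class: "(\<lambda>x. -1) \<in> sign_class \<mu> N"
proof -
  have "trig_poly (int N) (\<lambda>x. complex_of_real (poly [:-1:] (circle_cos x)))"
    by (rule trig_poly_poly_circle_cos) simp
  then show ?thesis
    using eventually_nonneg_circle by (simp add: sign_class_def prob_space)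
qed

lemma sign_uncertainty_le:
  assumes "f \<in> sign_class \<mu> N" "f \<noteq> (\<lambda>x. 0)"
  shows "sign_uncertainty \<mu> N \<le> last_sign_change f"
  unfolding sign_uncertainty_def
  by (rule cInf_lower)
    (use assms last_sign_change_nonneg[OF eventually_nonneg_circle] in \<open>auto intro!: bdd_belowI[of _ 0]\<close>)

lemma le_sign_uncertainty:
  assumes "\<And>f. f \<in> sign_class \<mu> N \<Longrightarrow> f \<noteq> (\<lambda>x. 0) \<Longrightarrow> m \<le> last_sign_change f"
  shows "m \<le> sign_uncertainty \<mu> N"
  unfolding sign_uncertainty_def
proof (rule cInf_greatest)
  show "{last_sign_change f |f. f \<in> sign_class \<mu> N \<and> f \<noteq> (\<lambda>x. 0)} \<noteq> {}"
    using minus_one_in_sign_class by (force simp: fun_eq_iff)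
qed (use assms in auto)

lemma le_quadrature_sup:
  assumes nodes: "quadrature_nodes \<mu> (N + 1) \<xi>"
  shows "Min ((\<lambda>y. dist y 0) ` \<xi>) \<le> quadrature_sup \<mu> (N + 1)"
proof -
  have "Min ((\<lambda>y. dist y 0) ` \<xi>) \<le> Sup {Min ((\<lambda>y. dist y 0) ` \<xi>) |\<xi>. quadrature_nodes \<mu> (N + 1) \<xi>}"
  proof (rule cSup_upper)
    show "bdd_above {Min ((\<lambda>y. dist y 0) ` \<xi>) |\<xi>. quadrature_nodes \<mu> (N + 1) \<xi>}"
      using quadrature_nodes_le_last_sign_change[OF _ minus_one_in_sign_class]
      by (intro bdd_aboveI[of _ "last_sign_change (\<lambda>x. -1)"]) (auto simp: fun_eq_iff)
  qed (use nodes in blast)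
  moreover have "\<exists>\<xi>. quadrature_nodes \<mu> (N + 1) \<xi>" using nodes by (rule exI)
  ultimately show ?thesis by (simp only: quadrature_sup_nodes)
qed

lemma quadrature_sup_nonneg: "0 \<le> quadrature_sup \<mu> (N + 1)"
proof (cases "\<exists>\<xi>. quadrature_nodes \<mu> (N + 1) \<xi>")
  case True
  then obtain \<xi> where \<xi>: "quadrature_nodes \<mu> (N + 1) \<xi>" by blast
  then have "finite \<xi>" "\<xi> \<noteq> {}" by (auto simp: quadrature_nodes_def)
  then have "0 \<le> Min ((\<lambda>y. dist y 0) ` \<xi>)"
    by (intro Min.boundedI) auto
  then show ?thesis using le_quadrature_sup[OF \<xi>] by linarith
next
  case False
  show ?thesis unfolding quadrature_sup_no_nodes[OF False] by (rule order_refl)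
qed

lemma quadrature_sup_le:
  assumes "\<And>\<xi>. quadrature_nodes \<mu> (N + 1) \<xi> \<Longrightarrow> Min ((\<lambda>y. dist y 0) ` \<xi>) \<le> m" and "0 \<le> m"
  shows "quadrature_sup \<mu> (N + 1) \<le> m"
proof (cases "\<exists>\<xi>. quadrature_nodes \<mu> (N + 1) \<xi>")
  case True
  then have "Sup {Min ((\<lambda>y. dist y 0) ` \<xi>) |\<xi>. quadrature_nodes \<mu> (N + 1) \<xi>} \<le> m"
    by (intro cSup_least) (use assms(1) in auto)
  then show ?thesis using True by (simp only: quadrature_sup_nodes)
next
  case False
  show ?thesis unfolding quadrature_sup_no_nodes[OF False] by fact
qed

lemma sign_uncertainty_eq_quadrature_sup:
  assumes "1 \<le> N"
  shows "sign_uncertainty \<mu> N = quadrature_sup \<mu> (N + 1)"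
proof (rule antisym)
  show "quadrature_sup \<mu> (N + 1) \<le> sign_uncertainty \<mu> N"
  proof (rule quadrature_sup_le)
    show "0 \<le> sign_uncertainty \<mu> N"
      using last_sign_change_nonneg[OF eventually_nonneg_circle] by (intro le_sign_uncertainty)
  qed (intro le_sign_uncertainty quadrature_nodes_le_last_sign_change)
  show "sign_uncertainty \<mu> N \<le> quadrature_sup \<mu> (N + 1)"
  proof (cases "\<exists>f. trig_poly (int N) (\<lambda>x. complex_of_real (f x)) \<and> f \<noteq> (\<lambda>x. 0) \<and>
      (\<forall>x. 0 \<le> f x) \<and> (\<integral>x. f x \<partial>\<mu>) \<le> 0")
    case True
    \<comment> \<open>A nonnegative \<open>f\<close> has no sign change, so the infimum is \<open>0\<close>.\<close>
    then obtain f where f: "f \<in> sign_class \<mu> N" "f \<noteq> (\<lambda>x. 0)" "\<And>x. 0 \<le> f x"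
      using eventually_nonneg_circle by (auto simp: sign_class_def)
    have "last_sign_change f \<le> 0"
    proof (rule field_le_epsilon)
      fix e :: real assume "0 < e"
      then show "last_sign_change f \<le> 0 + e"
        using f(3) by (simp add: last_sign_change_le)
    qed
    then show ?thesis
      using sign_uncertainty_le[OF f(1,2)] quadrature_sup_nonneg[of N] by linarith
  next
    case False
    then obtain \<xi> f where nodes: "quadrature_nodes \<mu> (N + 1) \<xi>"
      and f: "f \<in> sign_class \<mu> N" "f \<noteq> (\<lambda>x. 0)"
      and le: "\<And>y. y \<in> \<xi> \<Longrightarrow> last_sign_change f \<le> dist y 0"
      using ex_extremal_quadrature[OF \<open>1 \<le> N\<close>] by (metis not_le)
    have "finite \<xi>" "\<xi> \<noteq> {}" using nodes by (auto simp: quadrature_nodes_def)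
    then have "last_sign_change f \<le> Min ((\<lambda>y. dist y 0) ` \<xi>)"
      using le by simp
    then show ?thesis
      using sign_uncertainty_le[OF f] le_quadrature_sup[OF nodes] by linarith
  qed
qed

end

theorem theorem6:
  fixes \<mu> :: "circle measure" and N :: nat
  assumes "prob_space \<mu>"
    and "sets \<mu> = sets borel"
    and "\<And>A. A \<in> sets borel \<Longrightarrow> measure \<mu> A = measure \<mu> (uminus ` A)"
    and "1 \<le> N"
  shows "sign_uncertainty \<mu> N = quadrature_sup \<mu> (N + 1)"
proof -
  interpret prob_space \<mu> by fact
  interpret even_circle_measure \<mu>
    by standard (fact assms)+
  show ?thesis
    using \<open>1 \<le> N\<close> by (rule sign_uncertainty_eq_quadrature_sup)
qed

end
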